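(* Let $\mathbb{X}$ be a set with a symmetric neighbouring relation $\simeq$, and let $f : \mathbb{X} \to \mathbb{R}^d$ be a function with global $L_2$ sensitivity $\Delta = \sup_{x \simeq x'} \|f(x) - f(x')\|$, where $0 < \Delta < \infty$. Then for any $\varepsilon > 0$ and $\delta \in (0,1)$, the analytic Gaussian mechanism $M(x) = f(x) + Z$ with $Z \sim \mathcal{N}(0,\sigma^2 I)$, where $\sigma = \alpha \Delta/\sqrt{2\varepsilon}$ and $\alpha = \alpha(\varepsilon,\delta)$ is computed by the procedure described in the context, is $(\varepsilon,\delta)$-DP.
   Context: $\|\cdot\|$ is the Euclidean norm on $\mathbb{R}^d$, and $I$ is the $d\times d$ identity matrix. A randomized algorithm $M : \mathbb{X} \to \mathbb{Y}$ is $(\varepsilon,\delta)$-DP (differentially private) if for every pair of neighbouring inputs $x \simeq x'$ and every measurable set $E \subseteq \mathbb{Y}$ one has $\mathbb{P}[M(x) \in E] \leq e^{\varepsilon}\, \mathbb{P}[M(x') \in E] + \delta$. $\Phi(t) = \frac{1}{\sqrt{2\pi}}\int_{-\infty}^t e^{-y^2/2}\,dy$ is the standard Gaussian CDF. Analytic Gaussian mechanism (definition of $\alpha$). Let $\delta_0 = \Phi(0) - e^{\varepsilon}\Phi(-\sqrt{2\varepsilon})$. If $\delta \geq \delta_0$: define $B_{\varepsilon}^+(v) = \Phi(\sqrt{\varepsilon v}) - e^{\varepsilon}\Phi(-\sqrt{\varepsilon(v+2)})$ for $v \ge 0$, let $v^* = \sup\{v \in \mathbb{R}_{\geq 0} :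 B_{\varepsilon}^+(v) \leq \delta\}$, and let $\alpha = \sqrt{1+v^*/2} - \sqrt{v^*/2}$. If $\delta < \delta_0$: define $B_{\varepsilon}^-(u) = \Phi(-\sqrt{\varepsilon u}) - e^{\varepsilon}\Phi(-\sqrt{\varepsilon(u+2)})$ for $u \ge 0$, let $u^* = \inf\{u \in \mathbb{R}_{\geq 0} : B_{\varepsilon}^-(u) \leq \delta\}$, and let $\alpha = \sqrt{1+u^*/2} + \sqrt{u^*/2}$. The quantities $v^*$ and $u^*$ are taken to be the exact real values (exact arithmetic). *)

theory Defs
  imports "HOL-Probability.Probability"
begin

section \<open>Differential privacy\<close>

text \<open>
  A randomized algorithm on the input set \<open>X\<close> with outputs in the measurable space \<open>Y\<close> maps each
  input to the distribution of its output, a probability measure on \<open>Y\<close>.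
\<close>

definition randomized_algorithm :: "'x set \<Rightarrow> 'y measure \<Rightarrow> ('x \<Rightarrow> 'y measure) \<Rightarrow> bool" where
  "randomized_algorithm X Y M \<longleftrightarrow> (\<forall>x\<in>X. M x \<in> space (prob_algebra Y))"

definition differentially_private ::
  "'x set \<Rightarrow> ('x \<Rightarrow> 'x \<Rightarrow> bool) \<Rightarrow> 'y measure \<Rightarrow> real \<Rightarrow> real \<Rightarrow> ('x \<Rightarrow> 'y measure) \<Rightarrow> bool" where
  "differentially_private X nb Y \<epsilon> \<delta> M \<longleftrightarrow>
     randomized_algorithm X Y M \<and>
     (\<forall>x\<in>X. \<forall>x'\<in>X. nb x x' \<longrightarrow>
        (\<forall>E\<in>sets Y. measure (M x) E \<le> exp \<epsilon> * measure (M x') E + \<delta>))"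

text \<open>The supremum is taken in \<open>[0, \<infinity>]\<close>, so it always exists, and it is \<open>0\<close> if there are no neighbours.\<close>

definition l2_sensitivity ::
  "'x set \<Rightarrow> ('x \<Rightarrow> 'x \<Rightarrow> bool) \<Rightarrow> ('x \<Rightarrow> real ^ 'n) \<Rightarrow> ennreal" where
  "l2_sensitivity X nb f =
     (SUP (x, x') \<in> {(x, x'). x \<in> X \<and> x' \<in> X \<and> nb x x'}. ennreal (norm (f x - f x')))"

section \<open>Gaussian distributions\<close>

definition Phi :: "real \<Rightarrow> real" where
  "Phi = cdf std_normal_distribution"

lemma Phi_eq_integral:
  "Phi t = 1 / sqrt (2 * pi) * (LBINT y:{..t}. exp (- y\<^sup>2 / 2))"
proof -
  have "integrable lborel (\<lambda>y. std_normal_density y * indicator {..t} y)"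
    by (intro integrable_real_mult_indicator) auto
  then have "emeasure std_normal_distribution {..t}
      = ennreal (\<integral>y. std_normal_density y * indicator {..t} y \<partial>lborel)"
    by (simp add: emeasure_density nn_integral_eq_integral flip: ennreal_indicator ennreal_mult')
  then have "Phi t = (\<integral>y. std_normal_density y * indicator {..t} y \<partial>lborel)"
    by (simp add: Phi_def cdf_def measure_def)
  also have "\<dots> = (\<integral>y. 1 / sqrt (2 * pi) * (indicator {..t} y *\<^sub>R exp (- y\<^sup>2 / 2)) \<partial>lborel)"
    by (rule Bochner_Integration.integral_cong) (auto simp: std_normal_density_def)
  finally show ?thesis
    by (simp add: set_lebesgue_integral_def)
qed

text \<open>The normal distribution with mean \<open>\<mu>\<close> and positive definite covariance matrix \<open>\<Sigma>\<close>.\<close>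

definition multivariate_normal :: "real ^ 'n \<Rightarrow> real ^ 'n ^ 'n \<Rightarrow> (real ^ 'n) measure" where
  "multivariate_normal \<mu> \<Sigma> = density lborel (\<lambda>z. ennreal
     (exp (- ((z - \<mu>) \<bullet> (matrix_inv \<Sigma> *v (z - \<mu>))) / 2) / sqrt ((2 * pi) ^ CARD('n) * det \<Sigma>)))"

definition gaussian_mechanism ::
  "('x \<Rightarrow> real ^ 'n) \<Rightarrow> real \<Rightarrow> 'x \<Rightarrow> (real ^ 'n) measure" where
  "gaussian_mechanism f \<sigma> x =
     distr (multivariate_normal 0 (\<sigma>\<^sup>2 *\<^sub>R mat 1)) borel (\<lambda>z. f x + z)"

section \<open>Calibration of the analytic Gaussian mechanism\<close>

definition delta0 :: "real \<Rightarrow> real" where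
  "delta0 \<epsilon> = Phi 0 - exp \<epsilon> * Phi (- sqrt (2 * \<epsilon>))"

definition B_plus :: "real \<Rightarrow> real \<Rightarrow> real" where
  "B_plus \<epsilon> v = Phi (sqrt (\<epsilon> * v)) - exp \<epsilon> * Phi (- sqrt (\<epsilon> * (v + 2)))"

definition B_minus :: "real \<Rightarrow> real \<Rightarrow> real" where
  "B_minus \<epsilon> u = Phi (- sqrt (\<epsilon> * u)) - exp \<epsilon> * Phi (- sqrt (\<epsilon> * (u + 2)))"

text \<open>
  For \<open>\<epsilon> > 0\<close> and \<open>0 < \<delta> < 1\<close> the set below is nonempty and bounded above whenever
  \<open>\<delta> \<ge> delta0 \<epsilon>\<close>: \<open>B_plus \<epsilon> 0 = delta0 \<epsilon>\<close>, and \<open>B_plus \<epsilon> v\<close> tends to \<open>1\<close> as \<open>v\<close> grows.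
\<close>

definition v_star :: "real \<Rightarrow> real \<Rightarrow> real" where
  "v_star \<epsilon> \<delta> = Sup {v. 0 \<le> v \<and> B_plus \<epsilon> v \<le> \<delta>}"

text \<open>This set is nonempty for \<open>\<delta> > 0\<close>, since \<open>B_minus \<epsilon> u\<close> tends to \<open>0\<close> as \<open>u\<close> grows.\<close>

definition u_star :: "real \<Rightarrow> real \<Rightarrow> real" where
  "u_star \<epsilon> \<delta> = Inf {u. 0 \<le> u \<and> B_minus \<epsilon> u \<le> \<delta>}"

definition analytic_gaussian_alpha :: "real \<Rightarrow> real \<Rightarrow> real" where
  "analytic_gaussian_alpha \<epsilon> \<delta> =
     (if \<delta> \<ge> delta0 \<epsilon>
      then sqrt (1 + v_star \<epsilon> \<delta> / 2) - sqrt (v_star \<epsilon> \<delta> / 2)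
      else sqrt (1 + u_star \<epsilon> \<delta> / 2) + sqrt (u_star \<epsilon> \<delta> / 2))"

end

theory Submission
  imports Defs
begin

text \<open>
  Write \<open>g a = Phi a - exp \<epsilon> * Phi (- sqrt (a\<^sup>2 + 2 * \<epsilon>))\<close>. For two Gaussians of standard deviation \<open>\<sigma>\<close>
  whose means are at distance \<open>\<eta> * \<sigma>\<close>, the Neyman-Pearson lemma bounds the excess
  \<open>P E - exp \<epsilon> * Q E\<close> by its value on the halfspace where the likelihood ratio is at least \<open>exp \<epsilon>\<close>,
  and this value is \<open>g (\<eta> / 2 - \<epsilon> / \<eta>)\<close>. Both \<open>B_plus\<close> and \<open>B_minus\<close> are reparametrisations of \<open>g\<close>,
  so the calibration yields some \<open>a\<close> with \<open>g a \<le> \<delta>\<close>, and \<open>\<sigma>\<close> is chosen such that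
  \<open>\<eta> / 2 - \<epsilon> / \<eta> = a\<close> for means at distance \<open>\<Delta>\<close>. Closer means have a smaller \<open>\<eta> / 2 - \<epsilon> / \<eta>\<close>, and
  \<open>g\<close> is increasing.
\<close>

section \<open>Isotropic normal distributions\<close>

text \<open>The density is a product over the coordinates, so that Tonelli applies directly and
  independence of the coordinates can be read off. As in \<open>normal_density\<close>, the
  parameter \<open>\<sigma>\<close> is the standard deviation, not the variance.\<close>

definition isotropic_normal :: "'a::euclidean_space \<Rightarrow> real \<Rightarrow> 'a measure" where
  "isotropic_normal \<mu> \<sigma> = density lborel (\<lambda>z. \<Prod>b\<in>Basis. ennreal (normal_density (\<mu> \<bullet> b) \<sigma> (z \<bullet> b)))"

lemma sets_isotropic_normal [simp, measurable_cong]: "sets (isotropic_normal \<mu> \<sigma>) = sets borel"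
  by (simp add: isotropic_normal_def)

lemma space_isotropic_normal [simp]: "space (isotropic_normal \<mu> \<sigma>) = UNIV"
  by (simp add: isotropic_normal_def)

lemma prod_normal_density:
  fixes z \<mu> :: "'a::euclidean_space"
  shows "(\<Prod>b\<in>Basis. normal_density (\<mu> \<bullet> b) \<sigma> (z \<bullet> b))
    = exp (- (norm (z - \<mu>))\<^sup>2 / (2 * \<sigma>\<^sup>2)) / sqrt (2 * pi * \<sigma>\<^sup>2) ^ DIM('a)"
proof -
  have "(\<Prod>b\<in>Basis. normal_density (\<mu> \<bullet> b) \<sigma> (z \<bullet> b))
     = (\<Prod>b\<in>(Basis::'a set). 1 / sqrt (2 * pi * \<sigma>\<^sup>2)) * (\<Prod>b\<in>Basis. exp (- ((z - \<mu>) \<bullet> b)\<^sup>2 / (2 * \<sigma>\<^sup>2)))"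
    unfolding normal_density_def prod.distrib[symmetric] by (simp add: inner_diff_left)
  also have "(\<Prod>b\<in>Basis. exp (- ((z - \<mu>) \<bullet> b)\<^sup>2 / (2 * \<sigma>\<^sup>2)))
     = exp (\<Sum>b\<in>Basis. - ((z - \<mu>) \<bullet> b)\<^sup>2 / (2 * \<sigma>\<^sup>2))"
    by (simp add: exp_sum)
  also have "(\<Sum>b\<in>Basis. - ((z - \<mu>) \<bullet> b)\<^sup>2 / (2 * \<sigma>\<^sup>2)) = - (\<Sum>b\<in>Basis. ((z - \<mu>) \<bullet> b)\<^sup>2) / (2 * \<sigma>\<^sup>2)"
    by (simp add: sum_negf sum_divide_distrib)
  also have "(\<Sum>b\<in>Basis. ((z - \<mu>) \<bullet> b)\<^sup>2) = (norm (z - \<mu>))\<^sup>2"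
    unfolding power2_norm_eq_inner euclidean_inner[of "z - \<mu>" "z - \<mu>"] by (simp add: power2_eq_square)
  finally show ?thesis by (simp add: power_divide)
qed

text \<open>Coordinate-free form of the density, needed for the likelihood ratio of two such
  measures and for the comparison with \<open>multivariate_normal\<close>.\<close>

lemma isotropic_normal_eq_density:
  fixes \<mu> :: "'a::euclidean_space"
  shows "isotropic_normal \<mu> \<sigma> = density lborel
     (\<lambda>z. ennreal (exp (- (norm (z - \<mu>))\<^sup>2 / (2 * \<sigma>\<^sup>2)) / sqrt (2 * pi * \<sigma>\<^sup>2) ^ DIM('a)))"
  by (simp only: isotropic_normal_def prod_ennreal normal_density_nonneg flip: prod_normal_density)

text \<open>Both the density and the indicator of a box factor over the coordinates, so the integral
  does too. Total mass, marginals and independence below all follow from this formula.\<close>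

lemma emeasure_isotropic_normal_box:
  fixes \<mu> :: "'a::euclidean_space"
  assumes [measurable]: "\<And>b. b \<in> Basis \<Longrightarrow> A b \<in> sets borel"
  shows "emeasure (isotropic_normal \<mu> \<sigma>) {z. \<forall>b\<in>Basis. z \<bullet> b \<in> A b}
    = (\<Prod>b\<in>Basis. emeasure (density lborel (normal_density (\<mu> \<bullet> b) \<sigma>)) (A b))"
proof -
  have S [measurable]: "{z :: 'a. \<forall>b\<in>Basis. z \<bullet> b \<in> A b} \<in> sets borel"
  proof -
    have "{z :: 'a. \<forall>b\<in>Basis. z \<bullet> b \<in> A b} = (\<Inter>b\<in>Basis. (\<lambda>z. z \<bullet> b) -` A b \<inter> space borel)"
      by auto
    also have "\<dots> \<in> sets borel"
      by (intro sets.finite_INT measurable_sets[where A=borel]) (auto intro: assms)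
    finally show ?thesis .
  qed
  have ind: "indicator {z :: 'a. \<forall>b\<in>Basis. z \<bullet> b \<in> A b} z = (\<Prod>b\<in>Basis. indicator (A b) (z \<bullet> b) :: ennreal)"
    for z
    by (auto simp: indicator_def prod.If_cases prod_zero_iff)
  have "emeasure (isotropic_normal \<mu> \<sigma>) {z. \<forall>b\<in>Basis. z \<bullet> b \<in> A b}
     = (\<integral>\<^sup>+z. (\<Prod>b\<in>Basis. ennreal (normal_density (\<mu> \<bullet> b) \<sigma> (z \<bullet> b)) * indicator (A b) (z \<bullet> b)) \<partial>lborel)"
    unfolding isotropic_normal_def using S
    by (subst emeasure_density) (auto simp: ind prod.distrib intro!: nn_integral_cong)
  also have "\<dots> = (\<Prod>b\<in>Basis. \<integral>\<^sup>+x. ennreal (normal_density (\<mu> \<bullet> b) \<sigma> x) * indicator (A b) x \<partial>lborel)"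
    by (rule nn_integral_lborel_prod) auto
  also have "\<dots> = (\<Prod>b\<in>Basis. emeasure (density lborel (normal_density (\<mu> \<bullet> b) \<sigma>)) (A b))"
    by (intro prod.cong refl, subst emeasure_density) auto
  finally show ?thesis .
qed

lemma prob_space_isotropic_normal:
  fixes \<mu> :: "'a::euclidean_space"
  assumes "0 < \<sigma>"
  shows "prob_space (isotropic_normal \<mu> \<sigma>)"
proof
  have "emeasure (density lborel (normal_density m \<sigma>)) UNIV = 1" for m
    using prob_space.emeasure_space_1[OF prob_space_normal_density[OF assms, of m]] by simp
  then show "emeasure (isotropic_normal \<mu> \<sigma>) (space (isotropic_normal \<mu> \<sigma>)) = 1"
    using emeasure_isotropic_normal_box[of "\<lambda>_. UNIV" \<mu> \<sigma>] by simp
qed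

lemma distributed_isotropic_normal_coordinate:
  fixes \<mu> :: "'a::euclidean_space"
  assumes "0 < \<sigma>" "b \<in> Basis"
  shows "distributed (isotropic_normal \<mu> \<sigma>) lborel (\<lambda>z. z \<bullet> b) (normal_density (\<mu> \<bullet> b) \<sigma>)"
  unfolding distributed_def
proof (intro conjI measure_eqI)
  fix A :: "real set" assume "A \<in> sets (distr (isotropic_normal \<mu> \<sigma>) lborel (\<lambda>z. z \<bullet> b))"
  then have [measurable]: "A \<in> sets borel" by simp
  have 1: "emeasure (density lborel (normal_density m \<sigma>)) UNIV = 1" for m
    using prob_space.emeasure_space_1[OF prob_space_normal_density[OF assms(1), of m]] by simp
  have "emeasure (distr (isotropic_normal \<mu> \<sigma>) lborel (\<lambda>z. z \<bullet> b)) A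
     = emeasure (isotropic_normal \<mu> \<sigma>) {z. z \<bullet> b \<in> A}"
    by (subst emeasure_distr) (auto simp: vimage_def)
  \<comment> \<open>The event is a box whose sides are \<open>UNIV\<close> in all directions but
    \<open>b\<close>; these other sides contribute factors \<open>1\<close>.\<close>
  also have "{z :: 'a. z \<bullet> b \<in> A} = {z. \<forall>c\<in>Basis. z \<bullet> c \<in> (if c = b then A else UNIV)}"
    using assms by auto
  also have "emeasure (isotropic_normal \<mu> \<sigma>) \<dots>
     = (\<Prod>c\<in>Basis. if c = b then emeasure (density lborel (normal_density (\<mu> \<bullet> b) \<sigma>)) A else 1)"
    by (subst emeasure_isotropic_normal_box) (auto simp: 1 simp del: prod.delta intro!: prod.cong)
  also have "\<dots> = emeasure (density lborel (normal_density (\<mu> \<bullet> b) \<sigma>)) A"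
    using assms by (subst prod.delta) auto
  finally show "emeasure (distr (isotropic_normal \<mu> \<sigma>) lborel (\<lambda>z. z \<bullet> b)) A
    = emeasure (density lborel (normal_density (\<mu> \<bullet> b) \<sigma>)) A" .
qed auto

text \<open>Boxes determine a product of probability measures, so the joint law of the coordinates
  is the product of their laws as soon as both agree on boxes.\<close>

lemma indep_vars_isotropic_normal_coordinates:
  fixes \<mu> :: "'a::euclidean_space"
  assumes "0 < \<sigma>"
  shows "prob_space.indep_vars (isotropic_normal \<mu> \<sigma>) (\<lambda>_. borel) (\<lambda>b z. z \<bullet> b) Basis"
proof -
  interpret prob_space "isotropic_normal \<mu> \<sigma>" using assms by (rule prob_space_isotropic_normal)
  have D: "distr (isotropic_normal \<mu> \<sigma>) borel (\<lambda>z. z \<bullet> b) = density lborel (normal_density (\<mu> \<bullet> b) \<sigma>)"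
    if "b \<in> Basis" for b :: 'a
    using distributed_distr_eq_density[OF distributed_isotropic_normal_coordinate[OF assms that, of \<mu>]]
    by (simp cong: distr_cong)
  interpret P: product_prob_space "\<lambda>b. density lborel (normal_density (\<mu> \<bullet> b) \<sigma>)" "Basis :: 'a set"
    by (intro product_prob_spaceI prob_space_normal_density assms)
  have "distr (isotropic_normal \<mu> \<sigma>) (Pi\<^sub>M Basis (\<lambda>_. borel)) (\<lambda>z. \<lambda>b\<in>Basis. z \<bullet> b)
     = Pi\<^sub>M Basis (\<lambda>b. density lborel (normal_density (\<mu> \<bullet> b) \<sigma>))"
  proof (rule P.PiM_eqI)
    fix A :: "'a \<Rightarrow> real set"
    assume "\<And>b. b \<in> Basis \<Longrightarrow> A b \<in> sets (density lborel (normal_density (\<mu> \<bullet> b) \<sigma>))"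
    then have A: "\<And>b. b \<in> Basis \<Longrightarrow> A b \<in> sets borel" by simp
    have "emeasure (distr (isotropic_normal \<mu> \<sigma>) (Pi\<^sub>M Basis (\<lambda>_. borel)) (\<lambda>z. \<lambda>b\<in>Basis. z \<bullet> b)) (Pi\<^sub>E Basis A)
       = emeasure (isotropic_normal \<mu> \<sigma>) {z. \<forall>b\<in>Basis. z \<bullet> b \<in> A b}"
      using A by (subst emeasure_distr) (auto intro!: arg_cong2[where f=emeasure] measurable_restrict sets_PiM_I_finite simp: PiE_iff)
    then show "emeasure (distr (isotropic_normal \<mu> \<sigma>) (Pi\<^sub>M Basis (\<lambda>_. borel)) (\<lambda>z. \<lambda>b\<in>Basis. z \<bullet> b)) (Pi\<^sub>E Basis A)
       = (\<Prod>b\<in>Basis. emeasure (density lborel (normal_density (\<mu> \<bullet> b) \<sigma>)) (A b))"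
      using emeasure_isotropic_normal_box[OF A, where \<mu>=\<mu> and \<sigma>=\<sigma>] by simp
  qed (auto intro!: sets_PiM_cong)
  then show ?thesis
    by (subst indep_vars_iff_distr_eq_PiM') (auto simp: D cong: PiM_cong)
qed

text \<open>The inner product is a linear combination of independent normal variables, so it is
  normal with added means and variances.\<close>

lemma distributed_isotropic_normal_inner:
  fixes \<mu> w :: "'a::euclidean_space"
  assumes "0 < \<sigma>" "w \<noteq> 0"
  shows "distributed (isotropic_normal \<mu> \<sigma>) lborel (\<lambda>z. z \<bullet> w) (normal_density (\<mu> \<bullet> w) (\<sigma> * norm w))"
proof -
  interpret prob_space "isotropic_normal \<mu> \<sigma>" using assms(1) by (rule prob_space_isotropic_normal)
  \<comment> \<open>\<open>sum_indep_normal\<close> asks for positive standard deviations and a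
    nonempty index set. Directions orthogonal to \<open>w\<close> would give degenerate summands and
    are left out; \<open>w \<noteq> 0\<close> leaves at least one direction.\<close>
  define I where "I = {b \<in> Basis. w \<bullet> b \<noteq> 0}"
  have "finite I" by (simp add: I_def)
  moreover have "I \<noteq> {}" using \<open>w \<noteq> 0\<close> using euclidean_all_zero_iff[of w] by (auto simp: I_def)
  moreover have "indep_vars (\<lambda>_. borel) (\<lambda>b z. (w \<bullet> b) * (z \<bullet> b)) I"
    by (rule indep_vars_compose2[where X="\<lambda>b z. z \<bullet> b" and M'="\<lambda>_. borel" and Y="\<lambda>b x. (w \<bullet> b) * x"])
       (auto intro: indep_vars_subset[OF indep_vars_isotropic_normal_coordinates[OF assms(1)]] simp: I_def)
  moreover have "0 < \<bar>w \<bullet> b\<bar> * \<sigma>" if "b \<in> I" for b using that assms by (simp add: I_def)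
  moreover have "distributed (isotropic_normal \<mu> \<sigma>) lborel (\<lambda>z. (w \<bullet> b) * (z \<bullet> b))
      (normal_density ((w \<bullet> b) * (\<mu> \<bullet> b)) (\<bar>w \<bullet> b\<bar> * \<sigma>))" if "b \<in> I" for b
    using normal_density_affine[OF distributed_isotropic_normal_coordinate[OF assms(1), of b \<mu>], of "w \<bullet> b" 0] assms that
    by (simp add: I_def)
  ultimately have *: "distributed (isotropic_normal \<mu> \<sigma>) lborel (\<lambda>z. \<Sum>b\<in>I. (w \<bullet> b) * (z \<bullet> b))
      (normal_density (\<Sum>b\<in>I. (w \<bullet> b) * (\<mu> \<bullet> b)) (sqrt (\<Sum>b\<in>I. (\<bar>w \<bullet> b\<bar> * \<sigma>)\<^sup>2)))"
    by (rule sum_indep_normal)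
  have I: "(\<Sum>b\<in>I. (w \<bullet> b) * (z \<bullet> b)) = z \<bullet> w" for z
  proof -
    have "(\<Sum>b\<in>I. (w \<bullet> b) * (z \<bullet> b)) = (\<Sum>b\<in>Basis. (w \<bullet> b) * (z \<bullet> b))"
      unfolding I_def by (intro sum.mono_neutral_left) auto
    then show ?thesis by (simp add: euclidean_inner[of z w] mult.commute)
  qed
  have "(\<Sum>b\<in>I. (\<bar>w \<bullet> b\<bar> * \<sigma>)\<^sup>2) = (\<sigma> * norm w)\<^sup>2"
    using I[of w] by (simp add: power_mult_distrib power2_norm_eq_inner flip: sum_distrib_right)
      (simp add: power2_eq_square mult_ac)
  with * assms show ?thesis by (simp add: I real_sqrt_mult)
qed

lemma measure_isotropic_normal_halfspace:
  fixes \<mu> w :: "'a::euclidean_space"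
  assumes "0 < \<sigma>" "w \<noteq> 0"
  shows "measure (isotropic_normal \<mu> \<sigma>) {z. z \<bullet> w \<le> c} = Phi ((c - \<mu> \<bullet> w) / (\<sigma> * norm w))"
proof -
  interpret prob_space "isotropic_normal \<mu> \<sigma>" using assms(1) by (rule prob_space_isotropic_normal)
  define s where "s = \<sigma> * norm w"
  have s: "0 < s" using assms by (simp add: s_def)
  have "distributed (isotropic_normal \<mu> \<sigma>) lborel (\<lambda>z. (z \<bullet> w - \<mu> \<bullet> w) / s) std_normal_density"
    using distributed_isotropic_normal_inner[OF assms, of \<mu>] s unfolding s_def[symmetric]
    by (subst normal_standard_normal_convert[symmetric]) auto
  then have "std_normal_distribution = distr (isotropic_normal \<mu> \<sigma>) lborel (\<lambda>z. (z \<bullet> w - \<mu> \<bullet> w) / s)"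
    by (simp add: distributed_distr_eq_density)
  then have "Phi ((c - \<mu> \<bullet> w) / s) = measure (isotropic_normal \<mu> \<sigma>) {z. (z \<bullet> w - \<mu> \<bullet> w) / s \<le> (c - \<mu> \<bullet> w) / s}"
    unfolding Phi_def cdf_def by (simp add: measure_distr vimage_def)
  also have "{z. (z \<bullet> w - \<mu> \<bullet> w) / s \<le> (c - \<mu> \<bullet> w) / s} = {z. z \<bullet> w \<le> c}"
    using s by (auto simp: divide_le_cancel)
  finally show ?thesis by (simp add: s_def)
qed

section \<open>The standard normal distribution function\<close>

interpretation std_normal: real_distribution std_normal_distribution
  by (rule real_dist_normal_dist)

lemma Phi_nonneg: "0 \<le> Phi t"
  by (simp add: Phi_def std_normal.cdf_nonneg)

lemma Phi_tendsto_at_top: "(Phi \<longlongrightarrow> 1) at_top"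
  unfolding Phi_def by (rule std_normal.cdf_lim_at_top_prob)

lemma Phi_tendsto_at_bot: "(Phi \<longlongrightarrow> 0) at_bot"
  unfolding Phi_def by (rule std_normal.cdf_lim_at_bot)

text \<open>The fundamental theorem of calculus, applied in a bounded window around
  \<open>t\<close>: differentiability is local, so representing \<open>Phi\<close> there as an
  integral from \<open>t - 1\<close> suffices.\<close>

lemma Phi_has_real_derivative: "(Phi has_real_derivative std_normal_density t) (at t)"
proof -
  have eq: "Phi x = Phi (t - 1) + integral {t - 1..x} std_normal_density" if "x \<in> {t - 1<..<t + 1}" for x
  proof -
    have i: "set_integrable lborel {t - 1..x} std_normal_density"
      unfolding set_integrable_def
      by (rule integrable_mult_indicator) auto
    have "Phi x - Phi (t - 1) = measure std_normal_distribution {t - 1<..x}"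
      using that unfolding Phi_def by (subst std_normal.cdf_diff_eq) auto
    also have "\<dots> = (LBINT y:{t - 1<..x}. std_normal_density y)"
    proof -
      have "integrable lborel (\<lambda>y. std_normal_density y * indicator {t - 1<..x} y)"
        by (intro integrable_real_mult_indicator) auto
      then have "emeasure std_normal_distribution {t - 1<..x}
         = ennreal (\<integral>y. std_normal_density y * indicator {t - 1<..x} y \<partial>lborel)"
        by (simp add: emeasure_density nn_integral_eq_integral flip: ennreal_indicator ennreal_mult')
      then show ?thesis by (simp add: measure_def set_lebesgue_integral_def mult.commute)
    qed
    \<comment> \<open>Differences of a distribution function give half-open intervals; the added
      endpoint is a null set.\<close>
    also have "\<dots> = (LBINT y:{t - 1..x}. std_normal_density y)"
      unfolding set_lebesgue_integral_def
    proof (rule integral_cong_AE)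
      show "AE y in lborel. indicator {t - 1<..x} y *\<^sub>R std_normal_density y
          = indicator {t - 1..x} y *\<^sub>R std_normal_density y"
        using AE_lborel_singleton[of "t - 1"] by eventually_elim (simp add: indicator_def)
    qed simp_all
    also have "\<dots> = integral {t - 1..x} std_normal_density"
      by (rule set_borel_integral_eq_integral(2)[OF i])
    finally show ?thesis by simp
  qed
  have "continuous_on {t - 1..t + 1} std_normal_density"
    unfolding std_normal_density_def by (intro continuous_intros) auto
  then have "((\<lambda>x. integral {t - 1..x} std_normal_density) has_real_derivative std_normal_density t)
      (at t within {t - 1..t + 1})"
    by (rule integral_has_real_derivative) auto
  then have "((\<lambda>x. integral {t - 1..x} std_normal_density) has_real_derivative std_normal_density t) (at t)"
    by (subst (asm) at_within_Icc_at) auto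
  then have "((\<lambda>x. Phi (t - 1) + integral {t - 1..x} std_normal_density) has_real_derivative std_normal_density t) (at t)"
    by (auto intro!: derivative_eq_intros)
  then show ?thesis
    by (rule has_field_derivative_transform_within_open[where S="{t - 1<..<t + 1}"]) (auto simp: eq)
qed

section \<open>The privacy curve and the calibration\<close>

text \<open>The function \<open>g\<close> of the opening comment. One real argument covers both
  branches of the calibration: nonnegative values correspond to \<open>B_plus\<close>, nonpositive
  values to \<open>B_minus\<close>.\<close>

definition privacy_curve :: "real \<Rightarrow> real \<Rightarrow> real" where
  "privacy_curve \<epsilon> a = Phi a - exp \<epsilon> * Phi (- sqrt (a\<^sup>2 + 2 * \<epsilon>))"

text \<open>Adding \<open>2 * \<epsilon>\<close> to the squared argument multiplies the density by
  \<open>exp (- \<epsilon>)\<close>. This is what makes the two terms in the derivative of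
  \<open>privacy_curve\<close> share a common factor.\<close>

lemma std_normal_density_shift:
  assumes "0 < \<epsilon>"
  shows "exp \<epsilon> * std_normal_density (- sqrt (a\<^sup>2 + 2 * \<epsilon>)) = std_normal_density a"
proof -
  have "(sqrt (a\<^sup>2 + 2 * \<epsilon>))\<^sup>2 = a\<^sup>2 + 2 * \<epsilon>"
    using assms by (intro real_sqrt_pow2) (auto intro: add_nonneg_nonneg)
  then show ?thesis
    by (simp add: std_normal_density_def field_simps flip: exp_add)
qed

lemma privacy_curve_has_real_derivative:
  assumes "0 < \<epsilon>"
  shows "(privacy_curve \<epsilon> has_real_derivative
           std_normal_density a * (1 + a / sqrt (a\<^sup>2 + 2 * \<epsilon>))) (at a)"
proof -
  have pos: "0 < a\<^sup>2 + 2 * \<epsilon>" using assms by (intro add_nonneg_pos) auto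
  have "((\<lambda>a. - sqrt (a\<^sup>2 + 2 * \<epsilon>)) has_real_derivative - (a / sqrt (a\<^sup>2 + 2 * \<epsilon>))) (at a)"
    using pos by (auto intro!: derivative_eq_intros simp: field_simps)
  from DERIV_chain2[OF Phi_has_real_derivative this]
  have "(privacy_curve \<epsilon> has_real_derivative
      std_normal_density a - exp \<epsilon> * (std_normal_density (- sqrt (a\<^sup>2 + 2 * \<epsilon>)) * - (a / sqrt (a\<^sup>2 + 2 * \<epsilon>)))) (at a)"
    unfolding privacy_curve_def
    by (intro DERIV_diff Phi_has_real_derivative DERIV_cmult)
  also have "std_normal_density a - exp \<epsilon> * (std_normal_density (- sqrt (a\<^sup>2 + 2 * \<epsilon>)) * - (a / sqrt (a\<^sup>2 + 2 * \<epsilon>)))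
     = std_normal_density a + (exp \<epsilon> * std_normal_density (- sqrt (a\<^sup>2 + 2 * \<epsilon>))) * (a / sqrt (a\<^sup>2 + 2 * \<epsilon>))"
    by (simp add: mult.assoc)
  also have "\<dots> = std_normal_density a * (1 + a / sqrt (a\<^sup>2 + 2 * \<epsilon>))"
    unfolding std_normal_density_shift[OF assms] by (simp add: distrib_left)
  finally show ?thesis .
qed

lemma abs_less_sqrt_power2_add: "0 < c \<Longrightarrow> \<bar>a\<bar> < sqrt (a\<^sup>2 + c)"
  by (rule real_less_rsqrt) simp

text \<open>The derivative is a positive density times
  \<open>1 + x / sqrt (x\<^sup>2 + 2 * \<epsilon>)\<close>, and the quotient exceeds
  \<open>-1\<close> because the root exceeds the absolute value of \<open>x\<close>.\<close>

lemma privacy_curve_mono: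
  assumes "0 < \<epsilon>" "a \<le> b"
  shows "privacy_curve \<epsilon> a \<le> privacy_curve \<epsilon> b"
proof (rule DERIV_nonneg_imp_nondecreasing[OF assms(2)])
  fix x :: real
  have "- x < sqrt (x\<^sup>2 + 2 * \<epsilon>)" using abs_less_sqrt_power2_add[of "2 * \<epsilon>" x] assms by auto
  moreover have "0 < sqrt (x\<^sup>2 + 2 * \<epsilon>)" using assms by (auto intro: add_nonneg_pos)
  ultimately have "0 \<le> std_normal_density x * (1 + x / sqrt (x\<^sup>2 + 2 * \<epsilon>))"
    by (intro mult_nonneg_nonneg) (auto simp: field_simps)
  then show "\<exists>y. (privacy_curve \<epsilon> has_real_derivative y) (at x) \<and> 0 \<le> y"
    using privacy_curve_has_real_derivative[OF assms(1)] by blast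
qed

lemma continuous_on_privacy_curve: "0 < \<epsilon> \<Longrightarrow> continuous_on A (privacy_curve \<epsilon>)"
  by (intro continuous_at_imp_continuous_on ballI DERIV_isCont[OF privacy_curve_has_real_derivative])

lemma privacy_curve_tendsto_at_top:
  assumes "0 < \<epsilon>"
  shows "(privacy_curve \<epsilon> \<longlongrightarrow> 1) at_top"
proof -
  have "filterlim (\<lambda>a. sqrt (a\<^sup>2 + 2 * \<epsilon>)) at_top at_top"
    using filterlim_ident
  proof (rule filterlim_at_top_mono)
    show "\<forall>\<^sub>F a in at_top. a \<le> sqrt (a\<^sup>2 + 2 * \<epsilon>)"
      using abs_less_sqrt_power2_add[of "2 * \<epsilon>"] assms
      by (intro always_eventually allI) (smt (verit))
  qed
  then have "filterlim (\<lambda>a. - sqrt (a\<^sup>2 + 2 * \<epsilon>)) at_bot at_top"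
    by (simp add: filterlim_uminus_at_bot)
  from filterlim_compose[OF Phi_tendsto_at_bot this]
  have "((\<lambda>a. Phi a - exp \<epsilon> * Phi (- sqrt (a\<^sup>2 + 2 * \<epsilon>))) \<longlongrightarrow> 1 - exp \<epsilon> * 0) at_top"
    by (intro tendsto_intros Phi_tendsto_at_top)
  then show ?thesis by (simp add: privacy_curve_def[abs_def])
qed

lemma privacy_curve_le_Phi: "privacy_curve \<epsilon> a \<le> Phi a"
  by (simp add: privacy_curve_def Phi_nonneg)

lemma privacy_curve_eq_B_plus: "0 < \<epsilon> \<Longrightarrow> 0 \<le> v \<Longrightarrow> privacy_curve \<epsilon> (sqrt (\<epsilon> * v)) = B_plus \<epsilon> v"
  by (simp add: privacy_curve_def B_plus_def algebra_simps)

lemma privacy_curve_eq_B_minus: "0 < \<epsilon> \<Longrightarrow> 0 \<le> u \<Longrightarrow> privacy_curve \<epsilon> (- sqrt (\<epsilon> * u)) = B_minus \<epsilon> u"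
  by (simp add: privacy_curve_def B_minus_def algebra_simps)

text \<open>The supremum is attained: the set is closed by continuity of
  \<open>privacy_curve\<close>, contains \<open>0\<close> by the branch condition, and is bounded
  because the curve tends to \<open>1\<close>, which is above \<open>\<delta>\<close>.\<close>

lemma v_star_feasible:
  assumes "0 < \<epsilon>" "delta0 \<epsilon> \<le> \<delta>" "\<delta> < 1"
  shows "0 \<le> v_star \<epsilon> \<delta>" "B_plus \<epsilon> (v_star \<epsilon> \<delta>) \<le> \<delta>"
proof -
  let ?V = "{v. 0 \<le> v \<and> B_plus \<epsilon> v \<le> \<delta>}"
  have V: "?V = {v. 0 \<le> v \<and> privacy_curve \<epsilon> (sqrt (\<epsilon> * v)) \<le> \<delta>}"
    using assms by (auto simp: privacy_curve_eq_B_plus)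
  have "0 \<in> ?V" using assms by (simp add: B_plus_def delta0_def mult.commute)
  moreover have "closed ?V"
    unfolding V using assms
    by (intro closed_Collect_conj closed_Collect_le continuous_intros
        continuous_on_compose2[OF continuous_on_privacy_curve[of _ UNIV]]) auto
  moreover have "bdd_above ?V"
  proof -
    have "eventually (\<lambda>a. \<delta> < privacy_curve \<epsilon> a) at_top"
      using order_tendstoD(1)[OF privacy_curve_tendsto_at_top[OF assms(1)] \<open>\<delta> < 1\<close>] .
    then obtain a where a: "\<And>b. a \<le> b \<Longrightarrow> \<delta> < privacy_curve \<epsilon> b"
      by (auto simp: eventually_at_top_linorder)
    \<comment> \<open>From \<open>a\<close> on the curve stays above \<open>\<delta>\<close>, so a
      feasible \<open>v\<close> must have \<open>sqrt (\<epsilon> * v)\<close> below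
      \<open>a\<close>.\<close>
    have "v \<le> a\<^sup>2 / \<epsilon>" if "v \<in> ?V" for v
    proof -
      have "sqrt (\<epsilon> * v) < a" using that a[of "sqrt (\<epsilon> * v)"] unfolding V by force
      then have "\<epsilon> * v \<le> a\<^sup>2" by (intro sqrt_le_D) simp
      then show ?thesis using assms by (simp add: field_simps)
    qed
    then show ?thesis by (rule bdd_aboveI)
  qed
  ultimately have "v_star \<epsilon> \<delta> \<in> ?V"
    unfolding v_star_def by (intro closed_contains_Sup) auto
  then show "0 \<le> v_star \<epsilon> \<delta>" "B_plus \<epsilon> (v_star \<epsilon> \<delta>) \<le> \<delta>" by auto
qed

text \<open>The infimum is attained: the set is closed by continuity, bounded below by
  \<open>0\<close>, and nonempty because the curve lies below \<open>Phi\<close>, which tends to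
  \<open>0\<close> at minus infinity.\<close>

lemma u_star_feasible:
  assumes "0 < \<epsilon>" "0 < \<delta>"
  shows "0 \<le> u_star \<epsilon> \<delta>" "B_minus \<epsilon> (u_star \<epsilon> \<delta>) \<le> \<delta>"
proof -
  let ?U = "{u. 0 \<le> u \<and> B_minus \<epsilon> u \<le> \<delta>}"
  have U: "?U = {u. 0 \<le> u \<and> privacy_curve \<epsilon> (- sqrt (\<epsilon> * u)) \<le> \<delta>}"
    using assms by (auto simp: privacy_curve_eq_B_minus)
  have "closed ?U"
    unfolding U using assms
    by (intro closed_Collect_conj closed_Collect_le continuous_intros
        continuous_on_compose2[OF continuous_on_privacy_curve[of _ UNIV]]) auto
  moreover have "bdd_below ?U" by (rule bdd_belowI[of _ 0]) auto
  moreover have "?U \<noteq> {}"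
  proof -
    have "eventually (\<lambda>a. Phi a < \<delta>) at_bot"
      using order_tendstoD(2)[OF Phi_tendsto_at_bot \<open>0 < \<delta>\<close>] .
    then obtain a where a: "\<And>b. b \<le> a \<Longrightarrow> Phi b < \<delta>"
      by (auto simp: eventually_at_bot_linorder)
    \<comment> \<open>The argument must be nonpositive to have the form
      \<open>- sqrt (\<epsilon> * u)\<close>. Here \<open>- \<bar>a\<bar>\<close> is also at most
      \<open>a\<close>, and the matching \<open>u\<close> is
      \<open>a\<^sup>2 / \<epsilon>\<close>.\<close>
    have "privacy_curve \<epsilon> (- \<bar>a\<bar>) \<le> \<delta>"
      using a[of "- \<bar>a\<bar>"] privacy_curve_le_Phi[of \<epsilon> "- \<bar>a\<bar>"] by linarith
    then have "a\<^sup>2 / \<epsilon> \<in> ?U"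
      using assms unfolding U by simp
    then show ?thesis by blast
  qed
  ultimately have "u_star \<epsilon> \<delta> \<in> ?U"
    unfolding u_star_def by (intro closed_contains_Inf) auto
  then show "0 \<le> u_star \<epsilon> \<delta>" "B_minus \<epsilon> (u_star \<epsilon> \<delta>) \<le> \<delta>" by auto
qed

text \<open>The witness is \<open>sqrt (\<epsilon> * v_star \<epsilon> \<delta>)\<close> in the
  first branch and \<open>- sqrt (\<epsilon> * u_star \<epsilon> \<delta>)\<close> in the second.
  Its sign accounts for the opposite signs in the two formulas for \<open>\<alpha>\<close>, so
  everything later needs no case distinction on \<open>delta0\<close>.\<close>

lemma analytic_gaussian_alphaE:
  assumes "0 < \<epsilon>" "0 < \<delta>" "\<delta> < 1"
  obtains a where "privacy_curve \<epsilon> a \<le> \<delta>"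
    and "analytic_gaussian_alpha \<epsilon> \<delta> = (sqrt (a\<^sup>2 + 2 * \<epsilon>) - a) / sqrt (2 * \<epsilon>)"
proof -
  \<comment> \<open>With \<open>a\<^sup>2 = \<epsilon> * w\<close>, this expresses both roots in
    \<open>\<alpha>\<close> by \<open>a\<close> over the common denominator
    \<open>sqrt (2 * \<epsilon>)\<close>.\<close>
  have "1 + w / 2 = (\<epsilon> * w + 2 * \<epsilon>) / (2 * \<epsilon>)" "w / 2 = (\<epsilon> * w) / (2 * \<epsilon>)" for w
    using assms by (auto simp: field_simps)
  then have rescale: "sqrt (1 + w / 2) = sqrt (\<epsilon> * w + 2 * \<epsilon>) / sqrt (2 * \<epsilon>)"
      "sqrt (w / 2) = sqrt (\<epsilon> * w) / sqrt (2 * \<epsilon>)" for w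
    by (metis real_sqrt_divide)+
  show thesis
  proof (cases "delta0 \<epsilon> \<le> \<delta>")
    case True
    note v = v_star_feasible[OF assms(1) True assms(3)]
    show thesis
    proof (rule that)
      show "privacy_curve \<epsilon> (sqrt (\<epsilon> * v_star \<epsilon> \<delta>)) \<le> \<delta>"
        using v assms by (simp add: privacy_curve_eq_B_plus)
      show "analytic_gaussian_alpha \<epsilon> \<delta> = (sqrt ((sqrt (\<epsilon> * v_star \<epsilon> \<delta>))\<^sup>2 + 2 * \<epsilon>)
          - sqrt (\<epsilon> * v_star \<epsilon> \<delta>)) / sqrt (2 * \<epsilon>)"
        using True v(1) assms(1) by (simp add: analytic_gaussian_alpha_def rescale diff_divide_distrib)
    qed
  next
    case False
    note u = u_star_feasible[OF assms(1,2)]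
    show thesis
    proof (rule that)
      show "privacy_curve \<epsilon> (- sqrt (\<epsilon> * u_star \<epsilon> \<delta>)) \<le> \<delta>"
        using u assms by (simp add: privacy_curve_eq_B_minus)
      show "analytic_gaussian_alpha \<epsilon> \<delta> = (sqrt ((- sqrt (\<epsilon> * u_star \<epsilon> \<delta>))\<^sup>2 + 2 * \<epsilon>)
          - - sqrt (\<epsilon> * u_star \<epsilon> \<delta>)) / sqrt (2 * \<epsilon>)"
        using False u(1) assms(1) by (simp add: analytic_gaussian_alpha_def rescale add_divide_distrib)
    qed
  qed
qed

section \<open>The privacy profile of Gaussian noise\<close>

lemma measure_density_eq_integral:
  fixes p :: "'a \<Rightarrow> real"
  assumes "integrable N p" "\<And>x. 0 \<le> p x" "E \<in> sets N"
  shows "measure (density N p) E = (\<integral>x. p x * indicator E x \<partial>N)"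
proof -
  have "integrable N (\<lambda>x. p x * indicator E x)"
    using assms by (intro integrable_real_mult_indicator) auto
  then have "emeasure (density N p) E = ennreal (\<integral>x. p x * indicator E x \<partial>N)"
    using assms by (simp add: emeasure_density nn_integral_eq_integral flip: ennreal_indicator ennreal_mult')
  then show ?thesis using assms by (simp add: measure_def)
qed

text \<open>Each side is the integral of \<open>p x - k * q x\<close> over a set. The set on the
  right consists of exactly those points where this integrand is nonnegative, so the inequality
  already holds pointwise.\<close>

lemma Neyman_Pearson:
  fixes p q :: "'a \<Rightarrow> real"
  assumes p: "integrable N p" "\<And>x. 0 \<le> p x" and q: "integrable N q" "\<And>x. 0 \<le> q x"
    and E: "E \<in> sets N"
  shows "measure (density N p) E - k * measure (density N q) E
    \<le> measure (density N p) {x \<in> space N. k * q x \<le> p x} - k * measure (density N q) {x \<in> space N. k * q x \<le> p x}"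
proof -
  have [measurable]: "p \<in> borel_measurable N" "q \<in> borel_measurable N"
    using p q by auto
  have eq: "measure (density N p) A - k * measure (density N q) A
      = (\<integral>x. (p x - k * q x) * indicator A x \<partial>N)" if A: "A \<in> sets N" for A
  proof -
    have "integrable N (\<lambda>x. p x * indicator A x)" "integrable N (\<lambda>x. k * (q x * indicator A x))"
      using p q A by (auto intro!: integrable_real_mult_indicator integrable_mult_right)
    then show ?thesis
      using p q A by (simp add: measure_density_eq_integral left_diff_distrib mult.assoc)
  qed
  have int: "integrable N (\<lambda>x. (p x - k * q x) * indicator A x)" if "A \<in> sets N" for A
    using p q that by (intro integrable_real_mult_indicator) auto
  have S: "{x \<in> space N. k * q x \<le> p x} \<in> sets N" by measurable
  show ?thesis
    unfolding eq[OF E] eq[OF S]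
    by (intro integral_mono int E S) (auto simp: indicator_def)
qed

text \<open>With equal \<open>\<sigma>\<close> the terms quadratic in \<open>z\<close> cancel in the
  log-likelihood ratio. It is therefore affine, and the optimal set is a halfspace, whose two
  probabilities are values of \<open>Phi\<close>.\<close>

lemma isotropic_normal_privacy_profile:
  fixes \<mu> \<nu> :: "'a::euclidean_space"
  assumes "0 < \<sigma>" "0 < \<epsilon>" "\<mu> \<noteq> \<nu>" and E: "E \<in> sets borel"
  defines "\<eta> \<equiv> norm (\<mu> - \<nu>) / \<sigma>"
  shows "measure (isotropic_normal \<mu> \<sigma>) E
    \<le> exp \<epsilon> * measure (isotropic_normal \<nu> \<sigma>) E + privacy_curve \<epsilon> (\<eta> / 2 - \<epsilon> / \<eta>)"
proof -
  define C where "C = sqrt (2 * pi * \<sigma>\<^sup>2) ^ DIM('a)"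
  define p where "p m z = exp (- (norm (z - m))\<^sup>2 / (2 * \<sigma>\<^sup>2)) / C" for m z :: 'a
  define w where "w = \<nu> - \<mu>"
  \<comment> \<open>Expanding gives \<open>(norm (z - \<nu>))\<^sup>2 - (norm (z - \<mu>))\<^sup>2 =
    \<nu> \<bullet> \<nu> - \<mu> \<bullet> \<mu> - 2 * (z \<bullet> w)\<close>; requiring this to
    be at least \<open>2 * \<sigma>\<^sup>2 * \<epsilon>\<close> yields the threshold
    \<open>c\<close>. Taking \<open>w\<close> from \<open>\<mu>\<close> towards \<open>\<nu>\<close>
    makes the halfspace a lower one, as \<open>Phi\<close> requires.\<close>
  define c where "c = (\<nu> \<bullet> \<nu> - \<mu> \<bullet> \<mu>) / 2 - \<sigma>\<^sup>2 * \<epsilon>"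
  define S where "S = {z \<in> space lborel. exp \<epsilon> * p \<nu> z \<le> p \<mu> z}"
  have C: "0 < C" using assms by (simp add: C_def)
  have w: "w \<noteq> 0" and norm_w: "norm (\<mu> - \<nu>) = norm w"
    using assms by (auto simp: w_def norm_minus_commute)
  have \<eta>: "0 < \<eta>" using assms by (simp add: \<eta>_def)
  have iso: "isotropic_normal m \<sigma> = density lborel (p m)" for m :: 'a
    by (simp add: isotropic_normal_eq_density p_def[abs_def] C_def)
  have p_nonneg: "0 \<le> p m z" for m z using C by (simp add: p_def)
  have p_int: "integrable lborel (p m)" for m
  proof (rule integrableI_nonneg)
    show [measurable]: "p m \<in> borel_measurable lborel" unfolding p_def by measurable
    show "(\<integral>\<^sup>+z. ennreal (p m z) \<partial>lborel) < \<infinity>"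
      using prob_space.emeasure_space_1[OF prob_space_isotropic_normal[OF assms(1), of m]]
      by (simp add: iso emeasure_density)
  qed (simp add: p_nonneg)
  have "S = {z. z \<bullet> w \<le> c}"
  proof -
    have "exp \<epsilon> * p \<nu> z \<le> p \<mu> z \<longleftrightarrow> z \<bullet> w \<le> c" for z
    proof -
      have "exp \<epsilon> * p \<nu> z \<le> p \<mu> z \<longleftrightarrow>
          exp (\<epsilon> - (norm (z - \<nu>))\<^sup>2 / (2 * \<sigma>\<^sup>2)) \<le> exp (- (norm (z - \<mu>))\<^sup>2 / (2 * \<sigma>\<^sup>2))"
        using C by (simp add: p_def divide_le_cancel exp_diff exp_minus field_simps)
      also have "\<dots> \<longleftrightarrow> \<epsilon> * (2 * \<sigma>\<^sup>2) \<le> (norm (z - \<nu>))\<^sup>2 - (norm (z - \<mu>))\<^sup>2"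
      proof -
        have "\<epsilon> = \<epsilon> * (2 * \<sigma>\<^sup>2) / (2 * \<sigma>\<^sup>2)" using assms by simp
        then have "exp (\<epsilon> - (norm (z - \<nu>))\<^sup>2 / (2 * \<sigma>\<^sup>2)) \<le> exp (- (norm (z - \<mu>))\<^sup>2 / (2 * \<sigma>\<^sup>2))
            \<longleftrightarrow> (\<epsilon> * (2 * \<sigma>\<^sup>2) - (norm (z - \<nu>))\<^sup>2) / (2 * \<sigma>\<^sup>2) \<le> - (norm (z - \<mu>))\<^sup>2 / (2 * \<sigma>\<^sup>2)"
          by (metis diff_divide_distrib exp_le_cancel_iff)
        also have "\<dots> \<longleftrightarrow> \<epsilon> * (2 * \<sigma>\<^sup>2) - (norm (z - \<nu>))\<^sup>2 \<le> - (norm (z - \<mu>))\<^sup>2"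
          using assms by (subst divide_le_cancel) auto
        finally show ?thesis by auto
      qed
      also have "\<dots> \<longleftrightarrow> z \<bullet> w \<le> c"
        unfolding power2_norm_eq_inner c_def w_def
        by (simp add: inner_diff_left inner_diff_right inner_commute) (auto simp: algebra_simps)
      finally show ?thesis .
    qed
    then show ?thesis by (simp add: S_def)
  qed
  then have Phi_S: "measure (isotropic_normal m \<sigma>) S = Phi ((c - m \<bullet> w) / (\<sigma> * norm w))" for m
    by (simp add: measure_isotropic_normal_halfspace[OF assms(1) w])
  have "c - \<mu> \<bullet> w = (norm w)\<^sup>2 / 2 - \<sigma>\<^sup>2 * \<epsilon>" "c - \<nu> \<bullet> w = - ((norm w)\<^sup>2 / 2 + \<sigma>\<^sup>2 * \<epsilon>)"
    unfolding power2_norm_eq_inner c_def w_def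
    by (simp_all add: inner_diff_left inner_diff_right inner_commute field_simps)
  then have arg: "(c - \<mu> \<bullet> w) / (\<sigma> * norm w) = \<eta> / 2 - \<epsilon> / \<eta>"
      "(c - \<nu> \<bullet> w) / (\<sigma> * norm w) = - (\<eta> / 2 + \<epsilon> / \<eta>)"
    using assms(1) w unfolding \<eta>_def norm_w
    by (simp_all only:) (simp_all add: field_simps power2_eq_square)
  \<comment> \<open>The product of \<open>\<eta> / 2\<close> and \<open>\<epsilon> / \<eta>\<close>
    is \<open>\<epsilon> / 2\<close>, so the squares of their sum and difference differ by
    \<open>2 * \<epsilon>\<close>. Hence the root in \<open>privacy_curve\<close> is the negated
    argument of \<open>Phi\<close> at \<open>\<nu>\<close>.\<close>
  have "(\<eta> / 2 - \<epsilon> / \<eta>)\<^sup>2 + 2 * \<epsilon> = (\<eta> / 2 + \<epsilon> / \<eta>)\<^sup>2"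
    using \<eta> by (simp add: power2_eq_square field_simps)
  then have "sqrt ((\<eta> / 2 - \<epsilon> / \<eta>)\<^sup>2 + 2 * \<epsilon>) = \<eta> / 2 + \<epsilon> / \<eta>"
    using \<eta> assms by simp
  then have "measure (isotropic_normal \<mu> \<sigma>) S - exp \<epsilon> * measure (isotropic_normal \<nu> \<sigma>) S
      = privacy_curve \<epsilon> (\<eta> / 2 - \<epsilon> / \<eta>)"
    by (simp add: Phi_S arg privacy_curve_def)
  moreover have "measure (isotropic_normal \<mu> \<sigma>) E - exp \<epsilon> * measure (isotropic_normal \<nu> \<sigma>) E
      \<le> measure (isotropic_normal \<mu> \<sigma>) S - exp \<epsilon> * measure (isotropic_normal \<nu> \<sigma>) S"
    unfolding iso S_def using E by (intro Neyman_Pearson p_int p_nonneg) auto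
  ultimately show ?thesis by linarith
qed

section \<open>The Gaussian mechanism as an isotropic normal distribution\<close>

lemma matrix_inv_scaleR_mat:
  fixes c :: real
  assumes "c \<noteq> 0"
  shows "matrix_inv (c *\<^sub>R mat 1 :: real ^ 'n ^ 'n) = inverse c *\<^sub>R mat 1"
  unfolding matrix_inv_def
\<comment> \<open>\<open>matrix_inv\<close> chooses some two-sided inverse, so uniqueness is needed
  besides existence. The block proves uniqueness; existence is left to the closing
  \<open>qed\<close>.\<close>
proof (rule some_equality)
  fix A :: "real ^ 'n ^ 'n"
  assume "c *\<^sub>R mat 1 ** A = mat 1 \<and> A ** c *\<^sub>R mat 1 = mat 1"
  then have "c *\<^sub>R A = mat 1" by (simp flip: scalar_matrix_assoc)
  then show "A = inverse c *\<^sub>R mat 1" using assms by (simp flip: \<open>c *\<^sub>R A = mat 1\<close>)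
qed (use assms in \<open>simp add: matrix_scalar_ac flip: scalar_matrix_assoc\<close>)

lemma det_scaleR_mat: "det (c *\<^sub>R mat 1 :: real ^ 'n ^ 'n) = c ^ CARD('n)"
  by (subst det_diagonal) (simp_all add: mat_def)

text \<open>For a multiple of the identity the quadratic form is the squared norm divided by
  \<open>\<sigma>\<^sup>2\<close>, and the determinant is
  \<open>(\<sigma>\<^sup>2) ^ CARD('n)\<close>, so both factors match the coordinate-free
  density.\<close>

lemma multivariate_normal_eq_isotropic_normal:
  fixes \<mu> :: "real ^ 'n"
  assumes "0 < \<sigma>"
  shows "multivariate_normal \<mu> (\<sigma>\<^sup>2 *\<^sub>R mat 1) = isotropic_normal \<mu> \<sigma>"
proof -
  have sqrt: "sqrt ((2 * pi) ^ CARD('n) * (\<sigma>\<^sup>2) ^ CARD('n)) = sqrt (2 * pi * \<sigma>\<^sup>2) ^ CARD('n)"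
    by (simp only: real_sqrt_power flip: power_mult_distrib)
  have inv: "matrix_inv (\<sigma>\<^sup>2 *\<^sub>R mat 1) *v y = inverse (\<sigma>\<^sup>2) *\<^sub>R y" for y :: "real ^ 'n"
  proof -
    have "matrix_inv (\<sigma>\<^sup>2 *\<^sub>R mat 1 :: real ^ 'n ^ 'n) = inverse (\<sigma>\<^sup>2) *\<^sub>R mat 1"
      by (rule matrix_inv_scaleR_mat) (use assms in simp)
    then show ?thesis
      by (simp only: matrix_vector_mul_lid flip: scaleR_matrix_vector_assoc)
  qed
  have "- ((z - \<mu>) \<bullet> (matrix_inv (\<sigma>\<^sup>2 *\<^sub>R mat 1) *v (z - \<mu>))) / 2 = - (norm (z - \<mu>))\<^sup>2 / (2 * \<sigma>\<^sup>2)" for z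
    unfolding inv power2_norm_eq_inner inner_scaleR_right by (simp only: field_simps) simp
  then show ?thesis
    unfolding multivariate_normal_def isotropic_normal_eq_density det_scaleR_mat sqrt
    by (simp only: DIM_cart DIM_real mult_1_right)
qed

text \<open>Lebesgue measure is translation invariant and the density depends only on
  \<open>z - \<mu>\<close>.\<close>

lemma distr_isotropic_normal_translation:
  fixes \<mu> a :: "'a::euclidean_space"
  shows "distr (isotropic_normal \<mu> \<sigma>) borel (\<lambda>z. a + z) = isotropic_normal (a + \<mu>) \<sigma>"
proof -
  \<comment> \<open>Lebesgue measure is written as its own image under the shift by
    \<open>- a\<close>, so that \<open>distr_density_distr\<close> can undo this shift with the one
    by \<open>a\<close> and move it into the density.\<close>
  have "isotropic_normal \<mu> \<sigma> = density (distr lborel borel ((+) (- a)))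
      (\<lambda>z. \<Prod>b\<in>Basis. ennreal (normal_density (\<mu> \<bullet> b) \<sigma> (z \<bullet> b)))"
    by (simp add: isotropic_normal_def lborel_distr_plus)
  then have "distr (isotropic_normal \<mu> \<sigma>) borel (\<lambda>z. a + z)
      = distr (density (distr lborel borel ((+) (- a)))
          (\<lambda>z. \<Prod>b\<in>Basis. ennreal (normal_density (\<mu> \<bullet> b) \<sigma> (z \<bullet> b)))) lborel (\<lambda>z. a + z)"
    by (simp cong: distr_cong)
  also have "\<dots> = isotropic_normal (a + \<mu>) \<sigma>"
    by (subst distr_density_distr)
       (auto simp: isotropic_normal_def comp_def normal_density_def algebra_simps)
  finally show ?thesis .
qed

lemma gaussian_mechanism_eq_isotropic_normal:
  "0 < \<sigma> \<Longrightarrow> gaussian_mechanism f \<sigma> x = isotropic_normal (f x) \<sigma>"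
  by (simp add: gaussian_mechanism_def multivariate_normal_eq_isotropic_normal
      distr_isotropic_normal_translation)

lemma norm_diff_le_l2_sensitivity:
  assumes "l2_sensitivity X nb f = ennreal \<Delta>" "0 \<le> \<Delta>" "x \<in> X" "x' \<in> X" "nb x x'"
  shows "norm (f x - f x') \<le> \<Delta>"
proof -
  have "ennreal (norm (f x - f x')) \<le> l2_sensitivity X nb f"
    unfolding l2_sensitivity_def using assms by (intro SUP_upper2[of "(x, x')"]) auto
  then show ?thesis using assms by simp
qed

theorem theorem9:
  fixes X :: "'x set" and nb :: "'x \<Rightarrow> 'x \<Rightarrow> bool"
    and f :: "'x \<Rightarrow> real ^ 'n"
    and \<Delta> \<epsilon> \<delta> \<sigma> :: real
  assumes "symp_on X nb"
    and "l2_sensitivity X nb f = ennreal \<Delta>" and "0 < \<Delta>"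
    and "0 < \<epsilon>" and "0 < \<delta>" and "\<delta> < 1"
    and "\<sigma> = analytic_gaussian_alpha \<epsilon> \<delta> * \<Delta> / sqrt (2 * \<epsilon>)"
  shows "differentially_private X nb borel \<epsilon> \<delta> (gaussian_mechanism f \<sigma>)"
proof -
  obtain a where a: "privacy_curve \<epsilon> a \<le> \<delta>"
    and \<alpha>: "analytic_gaussian_alpha \<epsilon> \<delta> = (sqrt (a\<^sup>2 + 2 * \<epsilon>) - a) / sqrt (2 * \<epsilon>)"
    using analytic_gaussian_alphaE assms(4-6) by blast
  define s where "s = sqrt (a\<^sup>2 + 2 * \<epsilon>)"
  \<comment> \<open>Both \<open>s - a\<close> and \<open>s + a\<close> are positive; the first gives
    \<open>0 < \<sigma>\<close> and later permits multiplying inequalities by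
    \<open>s - a\<close>.\<close>
  have abs_a: "\<bar>a\<bar> < s"
    unfolding s_def using assms by (intro abs_less_sqrt_power2_add) simp
  have "s\<^sup>2 = a\<^sup>2 + 2 * \<epsilon>"
    unfolding s_def using assms by (intro real_sqrt_pow2 add_nonneg_nonneg) auto
  then have s: "(s + a) * (s - a) = 2 * \<epsilon>"
    by (simp add: power2_eq_square algebra_simps)
  have \<sigma>_eq: "\<sigma> = (s - a) * \<Delta> / (2 * \<epsilon>)"
    using assms by (simp add: \<alpha> s_def)
  have \<sigma>: "0 < \<sigma>"
    unfolding \<sigma>_eq using abs_a assms(3,4) by simp
  \<comment> \<open>Means at distance \<open>\<Delta>\<close> thus have
    \<open>\<eta> = s + a\<close>. Since \<open>(s + a) * (s - a) = 2 * \<epsilon>\<close>, there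
    \<open>\<epsilon> / \<eta> = (s - a) / 2\<close>, and
    \<open>\<eta> / 2 - \<epsilon> / \<eta>\<close> is exactly \<open>a\<close>.\<close>
  have "(s + a) * \<sigma> = \<Delta> * ((s + a) * (s - a)) / (2 * \<epsilon>)"
    by (simp add: \<sigma>_eq)
  then have \<Delta>: "\<Delta> = (s + a) * \<sigma>"
    using assms by (simp add: s)
  have "measure (gaussian_mechanism f \<sigma> x) E \<le> exp \<epsilon> * measure (gaussian_mechanism f \<sigma> x') E + \<delta>"
    if x: "x \<in> X" "x' \<in> X" "nb x x'" and E: "E \<in> sets borel" for x x' E
  proof (cases "f x = f x'")
    \<comment> \<open>Here \<open>\<eta>\<close> would be \<open>0\<close> and
      \<open>\<epsilon> / \<eta>\<close> meaningless. Both output laws coincide, and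
      \<open>exp \<epsilon> \<ge> 1\<close> with \<open>\<delta> > 0\<close> suffices.\<close>
    case True
    have "1 * measure (gaussian_mechanism f \<sigma> x) E \<le> exp \<epsilon> * measure (gaussian_mechanism f \<sigma> x) E"
      using assms by (intro mult_right_mono) auto
    then show ?thesis using True assms by (simp add: gaussian_mechanism_def)
  next
    case False
    define \<eta> where "\<eta> = norm (f x - f x') / \<sigma>"
    have \<eta>: "0 < \<eta>" using False \<sigma> by (simp add: \<eta>_def)
    have "norm (f x - f x') \<le> \<Delta>"
      using norm_diff_le_l2_sensitivity[OF assms(2) _ x] assms by simp
    then have \<eta>_le: "\<eta> \<le> s + a"
      using \<sigma> by (simp add: \<eta>_def \<Delta> divide_le_eq)
    \<comment> \<open>Increasing \<open>\<eta>\<close> to \<open>s + a\<close> increases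
      \<open>\<eta> / 2\<close> and decreases \<open>\<epsilon> / \<eta>\<close>; the two terms are
      bounded separately by their values at \<open>s + a\<close>.\<close>
    have "\<eta> * (s - a) \<le> 2 * \<epsilon>"
      using mult_right_mono[OF \<eta>_le, of "s - a"] abs_a s by simp
    then have "(s - a) / 2 \<le> \<epsilon> / \<eta>"
      using \<eta> by (simp add: field_simps)
    then have "\<eta> / 2 - \<epsilon> / \<eta> \<le> (s + a) / 2 - (s - a) / 2"
      using \<eta>_le by (intro diff_mono) auto
    then have "\<eta> / 2 - \<epsilon> / \<eta> \<le> a"
      by (simp add: diff_divide_distrib add_divide_distrib)
    then have "privacy_curve \<epsilon> (\<eta> / 2 - \<epsilon> / \<eta>) \<le> \<delta>"
      using privacy_curve_mono[OF assms(4)] a by (meson order_trans)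
    then show ?thesis
      using isotropic_normal_privacy_profile[OF \<sigma> assms(4) False E]
      by (simp add: gaussian_mechanism_eq_isotropic_normal \<sigma> flip: \<eta>_def)
  qed
  moreover have "randomized_algorithm X borel (gaussian_mechanism f \<sigma>)"
    by (auto simp: randomized_algorithm_def space_prob_algebra gaussian_mechanism_eq_isotropic_normal
        \<sigma> intro: prob_space_isotropic_normal)
  ultimately show ?thesis
    by (auto simp: differentially_private_def)
qed

end
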